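(* For $\varepsilon>0$, let $D_\varepsilon=\{y\in\mathcal{Y}:\pi_{Y=y}((x_\varepsilon,x_\varepsilon+\varepsilon])=1\text{ for some }x_\varepsilon\in\mathbb{R}\}$. If for some $\varepsilon>0$ we have $\mu(\{x\in\mathbb{R}:\mu(\{x\})+\pi_{X=x}(D_\varepsilon)=0\})>0$, then property $(\mathcal{R}_+)$ does not hold.
   Context: Setting: $\mathcal{Y}$ is a separable Banach space with Borel $\sigma$-algebra $\mathcal{B}(\mathcal{Y})$, and $\pi$ is a probability measure on $\mathbb{R}\times\mathcal{Y}$ (with its Borel $\sigma$-algebra) with first marginal $\mu$ on $\mathbb{R}$ and second marginal $\nu$ on $\mathcal{Y}$. Fix probability kernels $(\pi_{X=x})_{x\in\mathbb{R}}$ (probability measures on $\mathcal{Y}$) and $(\pi_{Y=y})_{y\in\mathcal{Y}}$ (probability measures on $\mathbb{R}$) disintegrating $\pi$: $\pi(dx,dy)=\mu(dx)\,\pi_{X=x}(dy)=\nu(dy)\,\pi_{Y=y}(dx)$. $L^1_+(\mu)$ denotes the set of non-negative elements of $L^1(\mu)$. Property $(\mathcal{R}_+)$: for every $f\in L^1_+(\mu)$ there exists a measurable $g:\mathcal{Y}\to\mathbb{R}_+=[0,\infty)$ such that $f(x)=\int_{\mathcal{Y}}g(y)\,\pi_{X=x}(dy)$ for $\mu$-a.e. $x$. *)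

theory Defs
  imports "HOL-Probability.Probability"
begin

text \<open>
  A separable Banach space is a type of sort \<open>{banach, second_countable_topology}\<close>. For such a
  type the Borel sigma-algebra of the product with the reals is the product of the two Borel
  sigma-algebras (\<open>borel_prod\<close>), so the slices below are measurable.
\<close>

definition disintegration_X ::
  "(real \<times> 'b::{banach, second_countable_topology}) measure \<Rightarrow> real measure \<Rightarrow> (real \<Rightarrow> 'b measure) \<Rightarrow> bool"
  where "disintegration_X \<pi> \<mu> \<pi>X \<longleftrightarrow>
    \<pi>X \<in> borel \<rightarrow>\<^sub>M prob_algebra borel \<and>
    (\<forall>A \<in> sets borel. emeasure \<pi> A = (\<integral>\<^sup>+ x. emeasure (\<pi>X x) {y. (x, y) \<in> A} \<partial>\<mu>))"

definition disintegration_Y ::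
  "(real \<times> 'b::{banach, second_countable_topology}) measure \<Rightarrow> 'b measure \<Rightarrow> ('b \<Rightarrow> real measure) \<Rightarrow> bool"
  where "disintegration_Y \<pi> \<nu> \<pi>Y \<longleftrightarrow>
    \<pi>Y \<in> borel \<rightarrow>\<^sub>M prob_algebra borel \<and>
    (\<forall>A \<in> sets borel. emeasure \<pi> A = (\<integral>\<^sup>+ y. emeasure (\<pi>Y y) {x. (x, y) \<in> A} \<partial>\<nu>))"

text \<open>
  Elements of \<open>L\<^sup>1\<^sub>+(\<mu>)\<close> are given by representatives, hence non-negativity almost everywhere.
  The integral of \<open>g\<close> is taken in \<open>[0, \<infinity>]\<close>: with the Bochner integral a non-integrable \<open>g\<close>
  would get the value 0.
\<close>

definition property_R_plus ::
  "real measure \<Rightarrow> (real \<Rightarrow> 'b::{banach, second_countable_topology} measure) \<Rightarrow> bool"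
  where "property_R_plus \<mu> \<pi>X \<longleftrightarrow>
    (\<forall>f :: real \<Rightarrow> real. integrable \<mu> f \<and> (AE x in \<mu>. 0 \<le> f x) \<longrightarrow>
      (\<exists>g :: 'b \<Rightarrow> real. g \<in> borel_measurable borel \<and> (\<forall>y. 0 \<le> g y) \<and>
        (AE x in \<mu>. ennreal (f x) = (\<integral>\<^sup>+ y. ennreal (g y) \<partial>\<pi>X x))))"

text \<open>
  This set is Borel whenever \<open>\<pi>Y\<close> is a probability kernel: with \<open>F\<close> the distribution function
  of \<open>\<pi>Y y\<close> and \<open>b = Inf {t. F t = 1}\<close>, membership of \<open>y\<close> means that \<open>b\<close> is finite and
  \<open>F (b - \<epsilon>) = 0\<close>.
\<close>

definition D_set :: "('b::{banach, second_countable_topology} \<Rightarrow> real measure) \<Rightarrow> real \<Rightarrow> 'b set"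
  where "D_set \<pi>Y \<epsilon> = {y. \<exists>x. measure (\<pi>Y y) {x<..x + \<epsilon>} = 1}"

end

(* The test function is the indicator of B = A \<inter> I, where I is a half-open interval of length
   \<epsilon> and A is the set of positive \<mu>-measure from the hypothesis. If g represents it, then g
   vanishes \<pi>-almost everywhere over the complement of B, so for \<nu>-almost every y with g y > 0 the
   measure \<pi>_{Y=y} is concentrated on B, hence on I, and y lies in D_\<epsilon>. But D_\<epsilon> is
   null for \<pi>_{X=x} whenever x \<in> A, so g integrates to 0 instead of 1 over almost every
   x \<in> B. *)
theory Submission
  imports Defs
begin

(* Right continuity of the distribution function turns the quantifier over the left endpoint into
   countable ones. Plain rational approximation of the interval would not do: it cannot tell
   (x, x + \<epsilon>] from [x, x + \<epsilon>]. *)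
lemma (in real_distribution) ex_interval_prob_1_iff:
  fixes \<epsilon> :: real
  assumes "\<epsilon> > 0"
  shows "(\<exists>x. prob {x<..x + \<epsilon>} = 1) \<longleftrightarrow>
    (\<forall>k::nat. \<exists>q\<in>\<rat>. cdf M (q + \<epsilon>) = 1 \<and> cdf M q < 1 / Suc k)"
proof
  assume "\<exists>x. prob {x<..x + \<epsilon>} = 1"
  then obtain x where x: "prob {x<..x + \<epsilon>} = 1" by blast
  have eq: "cdf M (x + \<epsilon>) - cdf M x = 1"
    using cdf_diff_eq[of x "x + \<epsilon>"] x assms by simp
  have le: "0 \<le> cdf M x" "cdf M t \<le> 1" for t
    using cdf_nonneg cdf_bounded_prob by auto
  have Fx: "cdf M x = 0" and Fe: "cdf M (x + \<epsilon>) = 1"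
    using eq le(1) le(2)[of "x + \<epsilon>"] by linarith+
  show "\<forall>k::nat. \<exists>q\<in>\<rat>. cdf M (q + \<epsilon>) = 1 \<and> cdf M q < 1 / Suc k"
  proof
    fix k :: nat
    have "(cdf M \<longlongrightarrow> 0) (at_right x)"
      using cdf_is_right_cont[of x] Fx by (simp add: continuous_within)
    then have "eventually (\<lambda>t. cdf M t < 1 / Suc k) (at_right x)"
      by (rule order_tendstoD) simp
    then obtain b where b: "x < b" "\<And>t. x < t \<Longrightarrow> t < b \<Longrightarrow> cdf M t < 1 / Suc k"
      by (auto simp: eventually_at_right_field)
    \<comment> \<open>Moving the left endpoint slightly to the right keeps the distribution function
      equal to 1 at the right endpoint, by monotonicity, and raises its value at the left endpoint
      by less than \<open>1 / Suc k\<close>, by right continuity.\<close>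
    obtain q where q: "q \<in> \<rat>" "x < q" "q < b"
      using Rats_dense_in_real[OF b(1)] by blast
    have "cdf M (x + \<epsilon>) \<le> cdf M (q + \<epsilon>)"
      using q by (intro cdf_nondecreasing) simp
    then have "cdf M (q + \<epsilon>) = 1" using Fe le(2)[of "q + \<epsilon>"] by simp
    then show "\<exists>q\<in>\<rat>. cdf M (q + \<epsilon>) = 1 \<and> cdf M q < 1 / Suc k"
      using q b(2) by blast
  qed
next
  assume "\<forall>k::nat. \<exists>q\<in>\<rat>. cdf M (q + \<epsilon>) = 1 \<and> cdf M q < 1 / Suc k"
  then obtain q :: "nat \<Rightarrow> real"
    where q1: "\<And>k. cdf M (q k + \<epsilon>) = 1" and qk: "\<And>k. cdf M (q k) < 1 / Suc k"
    by metis
  \<comment> \<open>The \<open>q k\<close> cannot drift to minus infinity, since the distribution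
    function tends to 0 there but equals 1 at every \<open>q k + \<epsilon>\<close>. Hence their
    infimum is a genuine real number.\<close>
  have "eventually (\<lambda>t. cdf M t < 1) at_bot"
    using cdf_lim_at_bot by (rule order_tendstoD) simp
  then obtain N where N: "\<And>t. t \<le> N \<Longrightarrow> cdf M t < 1"
    by (auto simp: eventually_at_bot_linorder)
  have bdd: "bdd_below (range q)"
  proof (rule bdd_belowI2)
    show "N - \<epsilon> \<le> q k" for k
      using N[of "q k + \<epsilon>"] q1[of k] by (cases "q k + \<epsilon> \<le> N") auto
  qed
  \<comment> \<open>The infimum serves as left endpoint: lying below every \<open>q k\<close>, it
    has distribution function value at most \<open>1 / Suc k\<close> for all \<open>k\<close>, hence
    0.\<close>
  define b where "b = (INF k. q k)"
  have "cdf M b \<le> 1 / Suc k" for k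
  proof -
    have "b \<le> q k" unfolding b_def by (rule cINF_lower[OF bdd]) simp
    then have "cdf M b \<le> cdf M (q k)" by (rule cdf_nondecreasing)
    then show ?thesis using qk[of k] by simp
  qed
  then have "cdf M b \<le> 0"
    by (intro LIMSEQ_le_const[OF LIMSEQ_Suc[OF lim_1_over_n]]) auto
  then have Fb: "cdf M b = 0" using cdf_nonneg[of b] by simp
  \<comment> \<open>The infimum need not be attained, so the value 1 is first obtained strictly to
    the right of \<open>b + \<epsilon>\<close>, where every \<open>t\<close> exceeds some
    \<open>q k + \<epsilon>\<close>; right continuity then carries it to
    \<open>b + \<epsilon>\<close> itself. The bound \<open>b + \<epsilon> + 1\<close> is
    arbitrary.\<close>
  have "eventually (\<lambda>t. cdf M t = 1) (at_right (b + \<epsilon>))"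
  proof (rule eventually_at_rightI)
    fix t assume t: "t \<in> {b + \<epsilon><..<b + \<epsilon> + 1}"
    then have "(INF k. q k) < t - \<epsilon>" by (simp add: b_def)
    then obtain k where "q k < t - \<epsilon>" using cINF_less_iff[OF _ bdd] by auto
    then have "cdf M (q k + \<epsilon>) \<le> cdf M t" by (intro cdf_nondecreasing) simp
    then show "cdf M t = 1" using q1[of k] cdf_bounded_prob[of t] by simp
  qed simp
  then have "(cdf M \<longlongrightarrow> 1) (at_right (b + \<epsilon>))"
    by (rule tendsto_eventually)
  moreover have "(cdf M \<longlongrightarrow> cdf M (b + \<epsilon>)) (at_right (b + \<epsilon>))"
    using cdf_is_right_cont[of "b + \<epsilon>"] by (simp add: continuous_within)
  ultimately have "cdf M (b + \<epsilon>) = 1"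
    by (rule tendsto_unique[rotated, symmetric]) simp
  then have "prob {b<..b + \<epsilon>} = 1"
    using cdf_diff_eq[of b "b + \<epsilon>"] assms Fb by simp
  then show "\<exists>x. prob {x<..x + \<epsilon>} = 1" by blast
qed

lemma prob_kernelD:
  assumes "K \<in> borel \<rightarrow>\<^sub>M prob_algebra borel"
  shows "prob_space (K x)" and "sets (K x) = sets borel" and "space (K x) = UNIV"
    and "A \<in> sets borel \<Longrightarrow> (\<lambda>x. emeasure (K x) A) \<in> borel_measurable borel"
    and "A \<in> sets borel \<Longrightarrow> (\<lambda>x. measure (K x) A) \<in> borel_measurable borel"
proof -
  have "K x \<in> space (prob_algebra borel)"
    using measurable_space[OF assms] by simp
  then show "prob_space (K x)" and s: "sets (K x) = sets borel"
    by (simp_all add: space_prob_algebra)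
  show "space (K x) = UNIV" using sets_eq_imp_space_eq[OF s] by simp
  have K: "K \<in> borel \<rightarrow>\<^sub>M subprob_algebra borel"
    using assms by (rule measurable_prob_algebraD)
  show "(\<lambda>x. emeasure (K x) A) \<in> borel_measurable borel" if "A \<in> sets borel"
    using measurable_compose[OF K measurable_emeasure_subprob_algebra[OF that]] .
  show "(\<lambda>x. measure (K x) A) \<in> borel_measurable borel" if "A \<in> sets borel"
    using measurable_compose[OF K measurable_measure_subprob_algebra[OF that]] .
qed

text \<open>The definition is an uncountable union over left endpoints. The rational criterion
  rewrites it as a countable intersection of countable unions of sets cut out by the maps
  \<open>y \<mapsto> cdf (K y) t\<close>, each of which is measurable for a kernel.\<close>

lemma D_set_in_borel:
  assumes K: "K \<in> borel \<rightarrow>\<^sub>M prob_algebra borel" and "\<epsilon> > 0"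
  shows "D_set K \<epsilon> \<in> sets borel"
proof -
  have "real_distribution (K y)" for y
    using prob_kernelD(1-3)[OF K, of y]
    by (simp add: real_distribution_def real_distribution_axioms_def)
  then have eq: "D_set K \<epsilon> =
    (\<Inter>k::nat. \<Union>q\<in>\<rat>. {y. cdf (K y) (q + \<epsilon>) = 1 \<and> cdf (K y) q < 1 / Suc k})"
    using real_distribution.ex_interval_prob_1_iff[OF _ \<open>\<epsilon> > 0\<close>]
    unfolding D_set_def by auto
  have [measurable]: "(\<lambda>y. cdf (K y) t) \<in> borel_measurable borel" for t
    unfolding cdf_def by (intro prob_kernelD(5)[OF K]) simp
  have "{y. cdf (K y) (q + \<epsilon>) = 1 \<and> cdf (K y) q < 1 / Suc k} \<in> sets borel"
    for q and k :: nat
    by measurable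
  then have "(\<Union>q\<in>\<rat>. {y. cdf (K y) (q + \<epsilon>) = 1 \<and> cdf (K y) q < 1 / Suc k}) \<in> sets borel"
    for k :: nat
    by (intro sets.countable_UN' countable_rat) blast
  then show ?thesis
    unfolding eq by (intro sets.countable_INT) blast+
qed

text \<open>For fixed \<open>x\<close> the slice of the rectangle is \<open>C\<close> or empty, so
  the integrand is an indicator times a kernel mass. Applied to both disintegrations of one
  rectangle, this translates an almost sure statement about one kernel into one about the
  other.\<close>

lemma nn_integral_prob_kernel_times_eq_0_iff:
  assumes K: "K \<in> borel \<rightarrow>\<^sub>M prob_algebra borel" and M: "sets M = sets borel"
    and A: "A \<in> sets borel" and C: "C \<in> sets borel"
  shows "(\<integral>\<^sup>+ x. emeasure (K x) {y. x \<in> A \<and> y \<in> C} \<partial>M) = 0 \<longleftrightarrow>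
    (AE x in M. x \<in> A \<longrightarrow> emeasure (K x) C = 0)"
proof -
  have eq: "emeasure (K x) {y. x \<in> A \<and> y \<in> C} = indicator A x * emeasure (K x) C" for x
    by (simp split: split_indicator)
  note [measurable] = A prob_kernelD(4)[OF K C]
  have "(\<lambda>x. indicator A x * emeasure (K x) C) \<in> borel_measurable borel" by measurable
  then have meas: "(\<lambda>x. indicator A x * emeasure (K x) C) \<in> borel_measurable M"
    by (simp add: measurable_cong_sets[OF M refl])
  show ?thesis
    unfolding eq nn_integral_0_iff_AE[OF meas]
    by (intro AE_cong) (auto split: split_indicator)
qed

text \<open>Countably many half-open intervals of length \<open>\<epsilon>\<close> tile the line, so
  \<open>A\<close> cannot be null on all of them. The intervals have exactly the shape that
  \<open>D_set\<close> asks for.\<close>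

lemma ex_interval_emeasure_pos:
  fixes M :: "real measure" and \<epsilon> :: real
  assumes M: "sets M = sets borel" and A: "A \<in> sets borel" and "emeasure M A > 0" and "\<epsilon> > 0"
  shows "\<exists>a. emeasure M (A \<inter> {a<..a + \<epsilon>}) > 0"
proof (rule ccontr)
  assume "\<nexists>a. emeasure M (A \<inter> {a<..a + \<epsilon>}) > 0"
  then have "A \<inter> {of_int n * \<epsilon><..of_int n * \<epsilon> + \<epsilon>} \<in> null_sets M" for n :: int
    using A M by (intro null_setsI) (auto simp: not_less)
  then have null: "(\<Union>n::int. A \<inter> {of_int n * \<epsilon><..of_int n * \<epsilon> + \<epsilon>}) \<in> null_sets M"
    by (intro null_sets_UN) auto
  have "\<exists>n::int. x \<in> {of_int n * \<epsilon><..of_int n * \<epsilon> + \<epsilon>}" for x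
  proof
    \<comment> \<open>The index is the ceiling minus one rather than the floor, because the tiles
      are open on the left and closed on the right.\<close>
    have "of_int (\<lceil>x / \<epsilon>\<rceil> - 1) < x / \<epsilon>" "x / \<epsilon> \<le> of_int (\<lceil>x / \<epsilon>\<rceil> - 1) + 1"
      by linarith+
    then have "of_int (\<lceil>x / \<epsilon>\<rceil> - 1) * \<epsilon> < x" "x \<le> (of_int (\<lceil>x / \<epsilon>\<rceil> - 1) + 1) * \<epsilon>"
      using \<open>\<epsilon> > 0\<close> by (simp_all only: pos_less_divide_eq pos_divide_le_eq)
    then show "x \<in> {of_int (\<lceil>x / \<epsilon>\<rceil> - 1) * \<epsilon><..of_int (\<lceil>x / \<epsilon>\<rceil> - 1) * \<epsilon> + \<epsilon>}"
      by (simp add: algebra_simps)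
  qed
  then have "A = (\<Union>n::int. A \<inter> {of_int n * \<epsilon><..of_int n * \<epsilon> + \<epsilon>})" by blast
  with null have "A \<in> null_sets M" by simp
  with \<open>emeasure M A > 0\<close> show False by auto
qed

theorem proposition2p6:
  fixes \<pi> :: "(real \<times> 'b::{banach, second_countable_topology}) measure"
    and \<mu> :: "real measure" and \<nu> :: "'b measure"
    and \<pi>X :: "real \<Rightarrow> 'b measure" and \<pi>Y :: "'b \<Rightarrow> real measure"
  assumes "prob_space \<pi>" and "sets \<pi> = sets borel"
    and "\<mu> = distr \<pi> borel fst" and "\<nu> = distr \<pi> borel snd"
    and "disintegration_X \<pi> \<mu> \<pi>X" and "disintegration_Y \<pi> \<nu> \<pi>Y"
    and "\<exists>\<epsilon>>0. measure \<mu> {x. measure \<mu> {x} + measure (\<pi>X x) (D_set \<pi>Y \<epsilon>) = 0} > 0"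
  shows "\<not> property_R_plus \<mu> \<pi>X"
proof
  assume R: "property_R_plus \<mu> \<pi>X"
  have KX: "\<pi>X \<in> borel \<rightarrow>\<^sub>M prob_algebra borel"
    and dX: "\<And>A. A \<in> sets borel \<Longrightarrow> emeasure \<pi> A = (\<integral>\<^sup>+ x. emeasure (\<pi>X x) {y. (x, y) \<in> A} \<partial>\<mu>)"
    using assms(5) by (auto simp: disintegration_X_def)
  have KY: "\<pi>Y \<in> borel \<rightarrow>\<^sub>M prob_algebra borel"
    and dY: "\<And>A. A \<in> sets borel \<Longrightarrow> emeasure \<pi> A = (\<integral>\<^sup>+ y. emeasure (\<pi>Y y) {x. (x, y) \<in> A} \<partial>\<nu>)"
    using assms(6) by (auto simp: disintegration_Y_def)
  have s\<mu>: "sets \<mu> = sets borel" and s\<nu>: "sets \<nu> = sets borel"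
    using assms by auto
  have "fst \<in> \<pi> \<rightarrow>\<^sub>M (borel :: real measure)"
    by (subst measurable_cong_sets[OF assms(2) refl])
      (rule borel_measurable_continuous_onI, intro continuous_intros)
  then interpret \<mu>: prob_space \<mu>
    unfolding assms(3) by (rule prob_space.prob_space_distr[OF assms(1)])
  obtain \<epsilon> where "\<epsilon> > 0"
    and pos: "measure \<mu> {x. measure \<mu> {x} + measure (\<pi>X x) (D_set \<pi>Y \<epsilon>) = 0} > 0"
    using assms(7) by blast
  define D where "D = D_set \<pi>Y \<epsilon>"
  define A where "A = {x. measure \<mu> {x} + measure (\<pi>X x) D = 0}"
  have D: "D \<in> sets borel"
    unfolding D_def using KY \<open>\<epsilon> > 0\<close> by (rule D_set_in_borel)
  have A_pos: "emeasure \<mu> A > 0"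
    using pos by (simp add: A_def D_def \<mu>.emeasure_eq_measure)
  \<comment> \<open>A non-measurable set has \<open>emeasure\<close> 0 by convention, so positivity
    of the mass already yields measurability of \<open>A\<close>.\<close>
  then have A: "A \<in> sets borel"
    using emeasure_notin_sets[of A \<mu>] s\<mu> by force
  have AD: "emeasure (\<pi>X x) D = 0" if "x \<in> A" for x
  proof -
    interpret prob_space "\<pi>X x" using prob_kernelD(1)[OF KX] .
    have "measure (\<pi>X x) D = 0"
      using that measure_nonneg[of \<mu> "{x}"] measure_nonneg[of "\<pi>X x" D] unfolding A_def mem_Collect_eq by linarith
    then show ?thesis by (simp add: emeasure_eq_measure)
  qed
  obtain a where "emeasure \<mu> (A \<inter> {a<..a + \<epsilon>}) > 0"
    using ex_interval_emeasure_pos[OF s\<mu> A A_pos \<open>\<epsilon> > 0\<close>] by blast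
  define B where "B = A \<inter> {a<..a + \<epsilon>}"
  have B_pos: "emeasure \<mu> B > 0"
    unfolding B_def by fact
  have B: "B \<in> sets borel" unfolding B_def using A by simp
  have "integrable \<mu> (indicator B :: real \<Rightarrow> real)"
    using B s\<mu> by (intro \<mu>.integrable_const_bound[where B = 1])
      (auto simp: measurable_cong_sets[OF s\<mu> refl] indicator_def)
  then have "\<exists>g :: 'b \<Rightarrow> real. g \<in> borel_measurable borel \<and> (\<forall>y. 0 \<le> g y) \<and>
      (AE x in \<mu>. ennreal (indicator B x) = (\<integral>\<^sup>+ y. ennreal (g y) \<partial>\<pi>X x))"
    using R unfolding property_R_plus_def by simp
  then obtain g :: "'b \<Rightarrow> real" where g [measurable]: "g \<in> borel_measurable borel"
    and g_nn: "\<And>y. 0 \<le> g y"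
    and fg: "AE x in \<mu>. ennreal (indicator B x) = (\<integral>\<^sup>+ y. ennreal (g y) \<partial>\<pi>X x)"
    by blast
  define G where "G = {y. g y > 0}"
  have G: "G \<in> sets borel" unfolding G_def by measurable
  have int_0_iff: "(\<integral>\<^sup>+ y. ennreal (g y) \<partial>\<pi>X x) = 0 \<longleftrightarrow> emeasure (\<pi>X x) G = 0" for x
  proof -
    have m: "(\<lambda>y. ennreal (g y)) \<in> borel_measurable (\<pi>X x)"
      by (subst measurable_cong_sets[OF prob_kernelD(2)[OF KX] refl]) measurable
    have "{y \<in> space (\<pi>X x). ennreal (g y) \<noteq> 0} = G"
      using g_nn by (auto simp: G_def prob_kernelD(3)[OF KX] ennreal_eq_0_iff not_le)
    then show ?thesis using nn_integral_0_iff[OF m] by simp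
  qed
  have "AE x in \<mu>. x \<in> - B \<longrightarrow> emeasure (\<pi>X x) G = 0"
    using fg
  proof eventually_elim
    case (elim x)
    then show ?case using int_0_iff[of x] by auto
  qed
  \<comment> \<open>The rectangle \<open>(- B) \<times> G\<close> is therefore null for
    \<open>\<pi>\<close>; disintegrating it along \<open>\<pi>Y\<close> instead gives information on
    the fibres over \<open>G\<close>.\<close>
  then have "(\<integral>\<^sup>+ x. emeasure (\<pi>X x) {y. x \<in> - B \<and> y \<in> G} \<partial>\<mu>) = 0"
    using B by (subst nn_integral_prob_kernel_times_eq_0_iff[OF KX s\<mu> _ G]) simp_all
  moreover have "emeasure \<pi> ((- B) \<times> G) = (\<integral>\<^sup>+ x. emeasure (\<pi>X x) {y. x \<in> - B \<and> y \<in> G} \<partial>\<mu>)"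
    using dX[of "(- B) \<times> G"] B G by (simp add: borel_Times)
  moreover have "emeasure \<pi> ((- B) \<times> G) = (\<integral>\<^sup>+ y. emeasure (\<pi>Y y) {x. y \<in> G \<and> x \<in> - B} \<partial>\<nu>)"
    using dY[of "(- B) \<times> G"] B G by (simp add: borel_Times conj_commute)
  ultimately have "AE y in \<nu>. y \<in> G \<longrightarrow> emeasure (\<pi>Y y) (- B) = 0"
    using nn_integral_prob_kernel_times_eq_0_iff[OF KY s\<nu> G, of "- B"] B by auto
  then have "AE y in \<nu>. y \<in> G \<longrightarrow> y \<in> D"
  proof eventually_elim
    case (elim y)
    show ?case
    proof
      assume "y \<in> G"
      interpret prob_space "\<pi>Y y" using prob_kernelD(1)[OF KY] .
      note [simp] = prob_kernelD(2,3)[OF KY]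
      have "prob (- B) = 0" using elim \<open>y \<in> G\<close> by (simp add: measure_def)
      then have "prob B = 1" using prob_compl[of B] B by (simp add: Compl_eq_Diff_UNIV)
      \<comment> \<open>The left endpoint \<open>a\<close> of the chosen interval witnesses
        membership in \<open>D\<close>, the same \<open>a\<close> for almost every \<open>y\<close>
        in \<open>G\<close>.\<close>
      moreover have "prob B \<le> prob {a<..a + \<epsilon>}"
        by (rule finite_measure_mono) (auto simp: B_def)
      ultimately have "prob {a<..a + \<epsilon>} = 1"
        using prob_le_1[of "{a<..a + \<epsilon>}"] by simp
      then show "y \<in> D" by (auto simp: D_def D_set_def)
    qed
  qed
  \<comment> \<open>The premise fails for almost every \<open>y\<close>, so the conclusion is
    vacuous; this form fits the rectangle \<open>UNIV \<times> (G - D)\<close>, whose nullity is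
    then passed back to \<open>\<pi>X\<close>.\<close>
  then have "AE y in \<nu>. y \<in> G - D \<longrightarrow> emeasure (\<pi>Y y) UNIV = 0"
    by eventually_elim auto
  then have "(\<integral>\<^sup>+ y. emeasure (\<pi>Y y) {x. y \<in> G - D \<and> x \<in> UNIV} \<partial>\<nu>) = 0"
    using G D by (subst nn_integral_prob_kernel_times_eq_0_iff[OF KY s\<nu>]) simp_all
  moreover have "emeasure \<pi> (UNIV \<times> (G - D)) =
      (\<integral>\<^sup>+ y. emeasure (\<pi>Y y) {x. y \<in> G - D \<and> x \<in> UNIV} \<partial>\<nu>)"
    using dY[of "UNIV \<times> (G - D)"] G D by (simp add: borel_Times)
  moreover have "emeasure \<pi> (UNIV \<times> (G - D)) =
      (\<integral>\<^sup>+ x. emeasure (\<pi>X x) {y. x \<in> UNIV \<and> y \<in> G - D} \<partial>\<mu>)"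
    using dX[of "UNIV \<times> (G - D)"] G D by (simp add: borel_Times)
  ultimately have "AE x in \<mu>. x \<in> UNIV \<longrightarrow> emeasure (\<pi>X x) (G - D) = 0"
    using nn_integral_prob_kernel_times_eq_0_iff[OF KX s\<mu>, of UNIV "G - D"] G D by auto
  \<comment> \<open>Over almost every point of \<open>B\<close>, both \<open>D\<close> and
    \<open>G - D\<close> are null for \<open>\<pi>X x\<close>. Then \<open>G\<close> is null as well
    and \<open>g\<close> integrates to 0, against the value 1 of the indicator.\<close>
  with fg have "AE x in \<mu>. x \<notin> B"
  proof eventually_elim
    case (elim x)
    show ?case
    proof
      assume "x \<in> B"
      then have "D \<in> null_sets (\<pi>X x)" "G - D \<in> null_sets (\<pi>X x)"
        using AD[of x] elim G D by (auto simp: B_def prob_kernelD(2)[OF KX])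
      then have "(G - D) \<union> D \<in> null_sets (\<pi>X x)" by (intro null_sets.Un)
      then have "emeasure (\<pi>X x) ((G - D) \<union> D) = 0" by (rule null_setsD1)
      moreover have "emeasure (\<pi>X x) G \<le> emeasure (\<pi>X x) ((G - D) \<union> D)"
        using G D by (intro emeasure_mono) (auto simp: prob_kernelD(2)[OF KX])
      ultimately have "(\<integral>\<^sup>+ y. ennreal (g y) \<partial>\<pi>X x) = 0"
        by (simp add: int_0_iff)
      with elim(1) \<open>x \<in> B\<close> show False by simp
    qed
  qed
  then have "B \<in> null_sets \<mu>"
    using B s\<mu> by (subst AE_iff_null_sets) auto
  with B_pos show False by auto
qed

end
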